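(* Let $M\ge 1$, let $\mu_1,\dots,\mu_M\in\mathbb{R}$, $\sigma_1,\dots,\sigma_M>0$, $P_i=\mathcal N(\mu_i,\sigma_i^2)$, $P_{\mathrm{ens}}=\frac1M\sum_{i=1}^M P_i$ and $P_*=\mathcal N(\mu_*,\sigma_*^2)$, where $\mu_*=\frac1M\sum_{i=1}^M\mu_i$ and $\sigma_*^2=\frac1M\sum_{i=1}^M(\sigma_i^2+\mu_i^2)-\mu_*^2$. Let $H$ and $d$ be the entropy and divergence functions of the squared error (SE) score, and write $\widehat{\mathrm{Var}}[\mu_i]=\frac1M\sum_{i=1}^M(\mu_i-\mu_* )^2$. Then the following hold. Bayes risks: $$\frac1M\sum_{i=1}^M H(P_i)=\frac1M\sum_{i=1}^M\sigma_i^2,\qquad H(P_{\mathrm{ens}})=H(P_* )=\sigma_*^2=\frac1M\sum_{i=1}^M(\sigma_i^2+\mu_i^2)-\mu_*^2.$$ Excess risks: $$\frac1{M^2}\sum_{i=1}^M\sum_{j=1}^M d(P_i,P_j)=\frac1{M^2}\sum_{i=1}^M\sum_{j=1}^M(\mu_j-\mu_i)^2=2\,\widehat{\mathrm{Var}}[\mu_i],$$ $$\frac1M\sum_{i=1}^M d(P_{\mathrm{ens}},P_i)=\frac1M\sum_{i=1}^M d(P_i,P_{\mathrm{ens}})=\widehat{\mathrm{Var}}[\mu_i],$$ $$\frac1M\sum_{i=1}^M d(P_*,P_i)=\frac1M\sum_{i=1}^M d(P_i,P_* )=\widehat{\mathrm{Var}}[\mu_i],$$ $$d(P_*,P_{\mathrm{ens}})=d(P_{\mathrm{ens}},P_*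 )=0.$$
   Context: For a probability measure $P$ on $\mathbb{R}$ with finite second moment and $y\in\mathbb{R}$, the squared error score is $\mathrm{SE}(P,y)=\big(y-\mathbb{E}_{Y\sim P}[Y]\big)^2$. For probability measures $P,Q$ the expected score is $S(P,Q)=\int \mathrm{SE}(P,y)\,dQ(y)$. The entropy function is $H(P)=S(P,P)$ and the divergence function is $d(P,Q)=S(P,Q)-H(Q)$ (first argument: prediction; second argument: true distribution). $\mathcal N(\mu,\sigma^2)$ is the Gaussian with mean $\mu$ and variance $\sigma^2$; $P_{\mathrm{ens}}$ is the equally weighted Gaussian mixture. *)

theory Defs
  imports "HOL-Probability.Probability"
begin

text \<open>The library's \<^term>\<open>normal_density\<close> takes the standard deviation as its second argument;
  here the second argument is the variance.\<close>

definition gaussian :: "real \<Rightarrow> real \<Rightarrow> real measure" where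
  "gaussian \<mu> v = density lborel (normal_density \<mu> (sqrt v))"

definition uniform_mixture :: "nat \<Rightarrow> (nat \<Rightarrow> real measure) \<Rightarrow> real measure" where
  "uniform_mixture M P =
     measure_of UNIV (sets borel) (\<lambda>A. (\<Sum>i=1..M. emeasure (P i) A) / of_nat M)"

text \<open>The score functionals below are meant for probability measures with a finite second moment;
  elsewhere they take whatever value the total Bochner integral assigns. The lemmas at the end of
  this theory show that Gaussians and their mixtures lie in the intended domain.\<close>

definition SE :: "real measure \<Rightarrow> real \<Rightarrow> real" where
  "SE P y = (y - (\<integral>x. x \<partial>P))\<^sup>2"

definition expected_score :: "real measure \<Rightarrow> real measure \<Rightarrow> real" where
  "expected_score P Q = (\<integral>y. SE P y \<partial>Q)"

definition SE_entropy :: "real measure \<Rightarrow> real" where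
  "SE_entropy P = expected_score P P"

definition SE_divergence :: "real measure \<Rightarrow> real measure \<Rightarrow> real" where
  "SE_divergence P Q = expected_score P Q - SE_entropy Q"

definition finite_second_moment :: "real measure \<Rightarrow> bool" where
  "finite_second_moment P \<longleftrightarrow>
     prob_space P \<and> sets P = sets borel \<and> integrable P (\<lambda>y. y\<^sup>2)"

lemma finite_second_moment_gaussian:
  assumes "v > 0"
  shows "finite_second_moment (gaussian \<mu> v)"
proof -
  have s: "sqrt v > 0" using assms by simp
  have "integrable lborel (\<lambda>x. normal_density \<mu> (sqrt v) x * (x - \<mu>) ^ 2)"
    by (rule integrable_normal_moment[OF s])
  moreover have "integrable lborel (\<lambda>x. normal_density \<mu> (sqrt v) x * (x - \<mu>) ^ 1)"
    by (rule integrable_normal_moment[OF s])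
  moreover have "integrable lborel (normal_density \<mu> (sqrt v))"
    by (rule integrable_normal_density[OF s])
  ultimately have "integrable lborel (\<lambda>x. normal_density \<mu> (sqrt v) x * (x - \<mu>) ^ 2
      + 2 * \<mu> * (normal_density \<mu> (sqrt v) x * (x - \<mu>) ^ 1)
      + \<mu>\<^sup>2 * normal_density \<mu> (sqrt v) x)"
    by (intro Bochner_Integration.integrable_add integrable_mult_right)
  also have "(\<lambda>x. normal_density \<mu> (sqrt v) x * (x - \<mu>) ^ 2
      + 2 * \<mu> * (normal_density \<mu> (sqrt v) x * (x - \<mu>) ^ 1)
      + \<mu>\<^sup>2 * normal_density \<mu> (sqrt v) x) = (\<lambda>x. normal_density \<mu> (sqrt v) x * x\<^sup>2)"
    by (auto simp: power2_eq_square algebra_simps)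
  finally have "integrable (gaussian \<mu> v) (\<lambda>y. y\<^sup>2)"
    unfolding gaussian_def by (subst integrable_density) auto
  moreover have "prob_space (gaussian \<mu> v)"
    unfolding gaussian_def by (rule prob_space_normal_density[OF s])
  ultimately show ?thesis
    by (simp add: finite_second_moment_def gaussian_def)
qed

lemma sets_uniform_mixture [simp]: "sets (uniform_mixture M P) = sets borel"
  unfolding uniform_mixture_def using sets.sigma_sets_eq[of "borel :: real measure"] by simp

lemma emeasure_uniform_mixture:
  assumes P: "\<And>i. i \<in> {1..M} \<Longrightarrow> sets (P i) = sets borel" and A: "A \<in> sets borel"
  shows "emeasure (uniform_mixture M P) A = (\<Sum>i=1..M. emeasure (P i) A) / of_nat M"
proof (rule emeasure_measure_of[OF uniform_mixture_def])
  show "countably_additive (sets (uniform_mixture M P))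
     (\<lambda>A. (\<Sum>i=1..M. emeasure (P i) A) / of_nat M)"
  proof (rule countably_additiveI)
    fix B :: "nat \<Rightarrow> real set"
    assume B: "range B \<subseteq> sets (uniform_mixture M P)" "disjoint_family B"
    have "(\<Sum>n. (\<Sum>i=1..M. emeasure (P i) (B n)) / of_nat M)
        = (\<Sum>i=1..M. \<Sum>n. emeasure (P i) (B n)) / of_nat M"
      by (simp add: ennreal_suminf_divide suminf_sum)
    also have "(\<Sum>i=1..M. \<Sum>n. emeasure (P i) (B n)) = (\<Sum>i=1..M. emeasure (P i) (\<Union>n. B n))"
      using B P by (intro sum.cong refl suminf_emeasure) auto
    finally show "(\<Sum>n. (\<Sum>i=1..M. emeasure (P i) (B n)) / of_nat M)
        = (\<Sum>i=1..M. emeasure (P i) (\<Union>n. B n)) / of_nat M" .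
  qed
qed (use A in \<open>auto simp: positive_def\<close>)

lemma nn_integral_uniform_mixture:
  assumes P: "\<And>i. i \<in> {1..M} \<Longrightarrow> sets (P i) = sets borel"
    and f: "f \<in> borel_measurable borel"
  shows "(\<integral>\<^sup>+x. f x \<partial>uniform_mixture M P) = (\<Sum>i=1..M. \<integral>\<^sup>+x. f x \<partial>P i) / of_nat M"
  using f
proof (induction rule: borel_measurable_induct)
  case (cong f g)
  then show ?case by simp
next
  case (set A)
  then show ?case using P emeasure_uniform_mixture[OF P set] by simp
next
  case (mult u c)
  have "(\<integral>\<^sup>+x. c * u x \<partial>P i) = c * (\<integral>\<^sup>+x. u x \<partial>P i)" if "i \<in> {1..M}" for i
    using mult(2) P[OF that] by (intro nn_integral_cmult) (simp cong: measurable_cong_sets)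
  moreover have "(\<integral>\<^sup>+x. c * u x \<partial>uniform_mixture M P) = c * (\<integral>\<^sup>+x. u x \<partial>uniform_mixture M P)"
    using mult(2) by (intro nn_integral_cmult) (simp cong: measurable_cong_sets)
  ultimately show ?case
    by (simp add: mult.IH sum_distrib_left ennreal_times_divide)
next
  case (add u v)
  have "(\<integral>\<^sup>+x. v x + u x \<partial>P i) = (\<integral>\<^sup>+x. v x \<partial>P i) + (\<integral>\<^sup>+x. u x \<partial>P i)" if "i \<in> {1..M}" for i
    using add P[OF that] by (intro nn_integral_add) (simp_all cong: measurable_cong_sets)
  moreover have "(\<integral>\<^sup>+x. v x + u x \<partial>uniform_mixture M P)
      = (\<integral>\<^sup>+x. v x \<partial>uniform_mixture M P) + (\<integral>\<^sup>+x. u x \<partial>uniform_mixture M P)"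
    using add by (intro nn_integral_add) (simp_all cong: measurable_cong_sets)
  ultimately show ?case
    by (simp add: add.IH sum.distrib add_divide_distrib_ennreal)
next
  case (seq U)
  have "(\<integral>\<^sup>+x. (SUP n. U n x) \<partial>P i) = (SUP n. \<integral>\<^sup>+x. U n x \<partial>P i)" if "i \<in> {1..M}" for i
    using seq P[OF that] by (intro nn_integral_monotone_convergence_SUP)
      (simp_all cong: measurable_cong_sets)
  then have "(\<Sum>i=1..M. \<integral>\<^sup>+x. (SUP n. U n x) \<partial>P i) = (\<Sum>i=1..M. SUP n. \<integral>\<^sup>+x. U n x \<partial>P i)"
    by simp
  also have "\<dots> = (SUP n. \<Sum>i=1..M. \<integral>\<^sup>+x. U n x \<partial>P i)"
    using seq by (intro ennreal_SUP_sum[symmetric])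
      (auto simp: incseq_def le_fun_def intro!: nn_integral_mono)
  finally have "(\<Sum>i=1..M. \<integral>\<^sup>+x. (SUP n. U n x) \<partial>P i) / of_nat M
      = (SUP n. (\<Sum>i=1..M. \<integral>\<^sup>+x. U n x \<partial>P i) / of_nat M)"
    by (simp add: SUP_divide_ennreal)
  moreover have "(\<integral>\<^sup>+x. (SUP n. U n x) \<partial>uniform_mixture M P)
      = (SUP n. \<integral>\<^sup>+x. U n x \<partial>uniform_mixture M P)"
    using seq by (intro nn_integral_monotone_convergence_SUP)
      (simp_all cong: measurable_cong_sets)
  ultimately show ?case
    by (simp add: seq.IH image_comp)
qed

lemma finite_second_moment_uniform_mixture:
  assumes M: "M \<ge> 1" and P: "\<And>i. i \<in> {1..M} \<Longrightarrow> finite_second_moment (P i)"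
  shows "finite_second_moment (uniform_mixture M P)"
proof -
  have sets: "\<And>i. i \<in> {1..M} \<Longrightarrow> sets (P i) = sets borel"
    using P by (auto simp: finite_second_moment_def)
  have "emeasure (P i) UNIV = 1" if "i \<in> {1..M}" for i
    using P[OF that] prob_space.emeasure_space_1[of "P i"] sets_eq_imp_space_eq[OF sets[OF that]]
    by (simp add: finite_second_moment_def)
  then have "emeasure (uniform_mixture M P) UNIV = of_nat M / of_nat M"
    using emeasure_uniform_mixture[of M P UNIV, OF sets] by simp
  then have "emeasure (uniform_mixture M P) UNIV = 1"
    using M by (simp add: less_top[symmetric])
  then have "prob_space (uniform_mixture M P)"
    using sets_eq_imp_space_eq[OF sets_uniform_mixture[of M P]] by (intro prob_spaceI) simp
  moreover have "integrable (uniform_mixture M P) (\<lambda>y. y\<^sup>2)"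
  proof (rule integrableI_bounded)
    have "(\<integral>\<^sup>+x. ennreal (norm (x\<^sup>2)) \<partial>P i) < \<infinity>" if "i \<in> {1..M}" for i
      using P[OF that] by (simp add: finite_second_moment_def integrable_iff_bounded)
    then have "(\<Sum>i=1..M. \<integral>\<^sup>+x. ennreal (norm (x\<^sup>2)) \<partial>P i) \<noteq> top"
      by (simp add: less_top)
    then have "(\<Sum>i=1..M. \<integral>\<^sup>+x. ennreal (norm (x\<^sup>2)) \<partial>P i) / of_nat M \<noteq> top"
      using M unfolding ennreal_divide_eq_top_iff by simp
    then show "(\<integral>\<^sup>+x. ennreal (norm (x\<^sup>2)) \<partial>uniform_mixture M P) < \<infinity>"
      using nn_integral_uniform_mixture[of M P "\<lambda>x. ennreal (norm (x\<^sup>2))", OF sets]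
      by (simp add: less_top)
  qed (simp cong: measurable_cong_sets)
  ultimately show ?thesis
    by (simp add: finite_second_moment_def)
qed

end

(* The squared error score of P depends on P only through its mean, so for any prediction P and any
   Q with finite second moment, H(Q) is the variance of Q and d(P, Q) is the squared distance of the
   two means. The Gaussian P_* has the mean and the variance of the mixture P_ens, so everything
   reduces to identities between empirical moments of the mu_i. *)
theory Submission
  imports Defs
begin

text \<open>Lifts \<open>nn_integral_uniform_mixture\<close> to signed functions through positive
  and negative parts. With \<open>has_bochner_integral\<close>, integrability under the mixture and
  the value of the integral come together, so no default value of the Bochner integral can
  intervene.\<close>

lemma has_bochner_integral_uniform_mixture:
  fixes f :: "real \<Rightarrow> real"
  assumes M: "M \<ge> 1"
    and P: "\<And>i. i \<in> {1..M} \<Longrightarrow> sets (P i) = sets borel"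
    and f: "\<And>i. i \<in> {1..M} \<Longrightarrow> has_bochner_integral (P i) f (I i)"
  shows "has_bochner_integral (uniform_mixture M P) f ((\<Sum>i=1..M. I i) / real M)"
proof -
  have int: "integrable (P i) f" if "i \<in> {1..M}" for i
    using f[OF that] by (auto simp: has_bochner_integral_iff)
  \<comment> \<open>Component 1 exists because \<open>M \<ge> 1\<close>; since all the
    sigma-algebras are \<open>borel\<close>, measurability on this one component suffices.\<close>
  have meas: "f \<in> borel_measurable borel"
    using borel_measurable_integrable[OF int[of 1]] P[of 1] M
    by (simp cong: measurable_cong_sets)
  have nonneg: "has_bochner_integral (uniform_mixture M P) g ((\<Sum>i=1..M. \<integral>x. g x \<partial>P i) / real M)"
    if g: "\<And>i. i \<in> {1..M} \<Longrightarrow> integrable (P i) g" "\<And>x. g x \<ge> 0"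
      and [measurable]: "g \<in> borel_measurable borel" for g :: "real \<Rightarrow> real"
  proof (rule has_bochner_integral_nn_integral)
    have "(\<integral>\<^sup>+x. g x \<partial>uniform_mixture M P) = (\<Sum>i=1..M. \<integral>\<^sup>+x. g x \<partial>P i) / of_nat M"
      by (rule nn_integral_uniform_mixture) (use P in auto)
    also have "(\<Sum>i=1..M. \<integral>\<^sup>+x. g x \<partial>P i) = (\<Sum>i=1..M. ennreal (\<integral>x. g x \<partial>P i))"
      using g by (intro sum.cong refl nn_integral_eq_integral) auto
    also have "\<dots> = ennreal (\<Sum>i=1..M. \<integral>x. g x \<partial>P i)"
      using g by (intro sum_ennreal) auto
    \<comment> \<open>Passing from \<open>ennreal\<close> division to real division requires the
      divisor to be positive, hence \<open>M \<ge> 1\<close>.\<close>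
    also have "\<dots> / of_nat M = ennreal ((\<Sum>i=1..M. \<integral>x. g x \<partial>P i) / real M)"
      using M g by (subst ennreal_of_nat_eq_real_of_nat, subst divide_ennreal)
        (auto intro!: sum_nonneg)
    finally show "(\<integral>\<^sup>+x. g x \<partial>uniform_mixture M P) = ennreal ((\<Sum>i=1..M. \<integral>x. g x \<partial>P i) / real M)" .
  qed (use g in \<open>auto intro!: divide_nonneg_nonneg sum_nonneg cong: measurable_cong_sets\<close>)
  have "has_bochner_integral (uniform_mixture M P) (\<lambda>x. max (f x) 0 - max (- f x) 0)
      ((\<Sum>i=1..M. \<integral>x. max (f x) 0 \<partial>P i) / real M - (\<Sum>i=1..M. \<integral>x. max (- f x) 0 \<partial>P i) / real M)"
    using int meas by (intro has_bochner_integral_diff nonneg) auto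
  also have "(\<lambda>x. max (f x) 0 - max (- f x) 0) = f"
    by (auto simp: max_def)
  also have "(\<Sum>i=1..M. \<integral>x. max (f x) 0 \<partial>P i) / real M - (\<Sum>i=1..M. \<integral>x. max (- f x) 0 \<partial>P i) / real M
      = (\<Sum>i=1..M. (\<integral>x. max (f x) 0 \<partial>P i) - (\<integral>x. max (- f x) 0 \<partial>P i)) / real M"
    by (simp add: sum_subtractf diff_divide_distrib)
  \<comment> \<open>On each component the two parts recombine to \<open>f\<close>, whose integral
    there is \<open>I i\<close>.\<close>
  also have "(\<Sum>i=1..M. (\<integral>x. max (f x) 0 \<partial>P i) - (\<integral>x. max (- f x) 0 \<partial>P i)) = (\<Sum>i=1..M. I i)"
  proof (rule sum.cong[OF refl])
    fix i assume i: "i \<in> {1..M}"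
    have "(\<integral>x. max (f x) 0 \<partial>P i) - (\<integral>x. max (- f x) 0 \<partial>P i) = (\<integral>x. max (f x) 0 - max (- f x) 0 \<partial>P i)"
      using int[OF i] by (intro Bochner_Integration.integral_diff[symmetric]) auto
    also have "(\<lambda>x. max (f x) 0 - max (- f x) 0) = f"
      by (auto simp: max_def)
    finally show "(\<integral>x. max (f x) 0 \<partial>P i) - (\<integral>x. max (- f x) 0 \<partial>P i) = I i"
      using f[OF i] by (simp add: has_bochner_integral_iff)
  qed
  finally show ?thesis .
qed

text \<open>The total mass is finite and |y| \<le> 1 + y^2, so a finite second moment forces a
  finite first moment.\<close>

lemma has_bochner_integral_id:
  assumes "finite_second_moment Q"
  shows "has_bochner_integral Q (\<lambda>y. y) (\<integral>y. y \<partial>Q)"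
proof -
  interpret prob_space Q using assms by (simp add: finite_second_moment_def)
  have sets: "sets Q = sets borel" and sq: "integrable Q (\<lambda>y. y\<^sup>2)"
    using assms by (simp_all add: finite_second_moment_def)
  have "(\<lambda>y. y) \<in> borel_measurable Q"
    unfolding measurable_cong_sets[OF sets refl] by simp
  then have "integrable Q (\<lambda>y. y)"
    using sq by (rule square_integrable_imp_integrable)
  then show ?thesis by (rule has_bochner_integral_integrable)
qed

lemma expected_score_eq:
  assumes Q: "finite_second_moment Q"
  shows "expected_score P Q
    = (\<integral>y. y\<^sup>2 \<partial>Q) - 2 * (\<integral>x. x \<partial>P) * (\<integral>y. y \<partial>Q) + (\<integral>x. x \<partial>P)\<^sup>2"
proof -
  interpret prob_space Q using Q by (simp add: finite_second_moment_def)
  let ?m = "\<integral>x. x \<partial>P"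
  have [simp]: "integrable Q (\<lambda>y. y)" "integrable Q (\<lambda>y. y\<^sup>2)"
    using has_bochner_integral_id[OF Q] Q
    by (auto simp: has_bochner_integral_iff finite_second_moment_def)
  have "expected_score P Q = (\<integral>y. y\<^sup>2 - 2 * ?m * y + ?m\<^sup>2 \<partial>Q)"
    unfolding expected_score_def SE_def
    by (intro Bochner_Integration.integral_cong refl) (simp add: power2_diff algebra_simps)
  \<comment> \<open>The constant term keeps its value because \<open>Q\<close> has total mass
    1.\<close>
  also have "\<dots> = (\<integral>y. y\<^sup>2 \<partial>Q) - 2 * ?m * (\<integral>y. y \<partial>Q) + ?m\<^sup>2"
    by (simp add: prob_space)
  finally show ?thesis .
qed

lemma SE_entropy_eq:
  assumes "finite_second_moment Q"
  shows "SE_entropy Q = (\<integral>y. y\<^sup>2 \<partial>Q) - (\<integral>y. y \<partial>Q)\<^sup>2"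
  unfolding SE_entropy_def expected_score_eq[OF assms] by (simp add: power2_eq_square)

text \<open>The second moment of \<open>Q\<close> cancels between score and entropy, and what
  remains is a perfect square in the two means.\<close>

lemma SE_divergence_eq:
  assumes "finite_second_moment Q"
  shows "SE_divergence P Q = ((\<integral>x. x \<partial>P) - (\<integral>y. y \<partial>Q))\<^sup>2"
  unfolding SE_divergence_def SE_entropy_eq[OF assms] expected_score_eq[OF assms]
  by (simp add: power2_eq_square algebra_simps)

lemma gaussian_mean:
  assumes "v > 0"
  shows "(\<integral>x. x \<partial>gaussian \<mu> v) = \<mu>"
proof -
  have s: "sqrt v > 0" using assms by simp
  show ?thesis
    unfolding gaussian_def by (subst integral_density) (auto simp: integral_normal_moment_nz_1[OF s])
qed

lemma SE_entropy_gaussian: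
  assumes v: "v > 0"
  shows "SE_entropy (gaussian \<mu> v) = v"
proof -
  have s: "sqrt v > 0" using v by simp
  have "SE_entropy (gaussian \<mu> v) = (\<integral>x. normal_density \<mu> (sqrt v) x * (x - \<mu>)\<^sup>2 \<partial>lborel)"
    unfolding SE_entropy_def expected_score_def SE_def gaussian_mean[OF v]
    unfolding gaussian_def by (subst integral_density) auto
  also have "\<dots> = v"
    \<comment> \<open>The case k = 1 of the even central moments: 2! / ((2 / v) * 1!) = v.\<close>
    using integral_normal_moment_even[OF s, of \<mu> 1] v by simp
  finally show ?thesis .
qed

text \<open>The empirical form of Var X = E X^2 - (E X)^2: since the \<open>x i\<close> sum to
  \<open>card A * m\<close>, the cross term contributes -2 m^2 after averaging.\<close>

lemma sum_square_diff_center: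
  fixes x :: "'a \<Rightarrow> real"
  assumes "finite A" "A \<noteq> {}" and m: "m = (\<Sum>i\<in>A. x i) / card A"
  shows "(\<Sum>i\<in>A. (x i - m)\<^sup>2) / card A = (\<Sum>i\<in>A. (x i)\<^sup>2) / card A - m\<^sup>2"
proof -
  have c: "real (card A) \<noteq> 0" using assms by simp
  have "(\<Sum>i\<in>A. (x i - m)\<^sup>2) = (\<Sum>i\<in>A. (x i)\<^sup>2) - 2 * m * (\<Sum>i\<in>A. x i) + card A * m\<^sup>2"
    by (simp add: power2_diff sum.distrib sum_subtractf sum_distrib_left sum_distrib_right mult_ac)
  also have "(\<Sum>i\<in>A. x i) = card A * m" using c m by simp
  finally show ?thesis using c by (simp add: field_simps power2_eq_square)
qed

text \<open>Two independent draws from the empirical distribution differ by twice its variance in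
  mean square. The double sum expands to twice the sum of squares times \<open>card A\<close>, minus
  twice the squared sum.\<close>

lemma sum_square_diff_pairs:
  fixes x :: "'a \<Rightarrow> real"
  assumes "finite A" "A \<noteq> {}" and m: "m = (\<Sum>i\<in>A. x i) / card A"
  shows "(\<Sum>i\<in>A. \<Sum>j\<in>A. (x j - x i)\<^sup>2) / (card A)\<^sup>2 = 2 * ((\<Sum>i\<in>A. (x i - m)\<^sup>2) / card A)"
proof -
  have c: "real (card A) \<noteq> 0" using assms by simp
  have "(\<Sum>i\<in>A. \<Sum>j\<in>A. (x j - x i)\<^sup>2)
      = 2 * card A * (\<Sum>i\<in>A. (x i)\<^sup>2) - 2 * (\<Sum>i\<in>A. x i) * (\<Sum>j\<in>A. x j)"
    by (simp add: power2_diff sum.distrib sum_subtractf sum_distrib_left sum_distrib_right mult_ac)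
  also have "(\<Sum>i\<in>A. x i) = card A * m" using c m by simp
  finally show ?thesis
    unfolding sum_square_diff_center[OF assms] using c
    by (simp add: field_simps power2_eq_square)
qed

theorem mainTheorem4:
  fixes M :: nat
    and \<mu> \<sigma> :: "nat \<Rightarrow> real"
    and P :: "nat \<Rightarrow> real measure"
    and P_ens P_star :: "real measure"
    and \<mu>_star var_star Var_hat :: real
  assumes "M \<ge> 1"
    and "\<And>i. i \<in> {1..M} \<Longrightarrow> \<sigma> i > 0"
    and "\<And>i. i \<in> {1..M} \<Longrightarrow> P i = gaussian (\<mu> i) ((\<sigma> i)\<^sup>2)"
    and "P_ens = uniform_mixture M P"
    and "\<mu>_star = (\<Sum>i=1..M. \<mu> i) / real M"
    and "var_star = (\<Sum>i=1..M. (\<sigma> i)\<^sup>2 + (\<mu> i)\<^sup>2) / real M - \<mu>_star\<^sup>2"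
    and "P_star = gaussian \<mu>_star var_star"
    and "Var_hat = (\<Sum>i=1..M. (\<mu> i - \<mu>_star)\<^sup>2) / real M"
  shows
    "(\<Sum>i=1..M. SE_entropy (P i)) / real M = (\<Sum>i=1..M. (\<sigma> i)\<^sup>2) / real M \<and>
     SE_entropy P_ens = SE_entropy P_star \<and>
     SE_entropy P_star = var_star \<and>
     var_star = (\<Sum>i=1..M. (\<sigma> i)\<^sup>2 + (\<mu> i)\<^sup>2) / real M - \<mu>_star\<^sup>2 \<and>

     (\<Sum>i=1..M. \<Sum>j=1..M. SE_divergence (P i) (P j)) / (real M)\<^sup>2
       = (\<Sum>i=1..M. \<Sum>j=1..M. (\<mu> j - \<mu> i)\<^sup>2) / (real M)\<^sup>2 \<and>
     (\<Sum>i=1..M. \<Sum>j=1..M. (\<mu> j - \<mu> i)\<^sup>2) / (real M)\<^sup>2 = 2 * Var_hat \<and>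

     (\<Sum>i=1..M. SE_divergence P_ens (P i)) / real M
       = (\<Sum>i=1..M. SE_divergence (P i) P_ens) / real M \<and>
     (\<Sum>i=1..M. SE_divergence (P i) P_ens) / real M = Var_hat \<and>

     (\<Sum>i=1..M. SE_divergence P_star (P i)) / real M
       = (\<Sum>i=1..M. SE_divergence (P i) P_star) / real M \<and>
     (\<Sum>i=1..M. SE_divergence (P i) P_star) / real M = Var_hat \<and>

     SE_divergence P_star P_ens = SE_divergence P_ens P_star \<and>
     SE_divergence P_ens P_star = 0"
proof -
  note M = assms(1) and \<sigma> = assms(2) and P = assms(3)
  have var_hat: "Var_hat = (\<Sum>i=1..M. (\<mu> i)\<^sup>2) / real M - \<mu>_star\<^sup>2"
    unfolding assms(8) using sum_square_diff_center[of "{1..M}" \<mu>_star \<mu>] M assms(5) by simp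
  have pairs: "(\<Sum>i=1..M. \<Sum>j=1..M. (\<mu> j - \<mu> i)\<^sup>2) / (real M)\<^sup>2 = 2 * Var_hat"
    unfolding assms(8) using sum_square_diff_pairs[of "{1..M}" \<mu>_star \<mu>] M assms(5) by simp
  \<comment> \<open>Law of total variance: \<open>var_star\<close> is the average of the component
    variances (positive) plus \<open>Var_hat\<close> (nonnegative). Positivity makes
    \<open>P_star\<close> a genuine Gaussian; at variance 0, \<open>normal_density\<close> would
    divide by zero and vanish identically.\<close>
  have "(\<Sum>i=1..M. (\<sigma> i)\<^sup>2) / real M > 0"
    using M \<sigma> by (intro divide_pos_pos sum_pos) (auto simp: less_imp_neq[THEN not_sym])
  moreover have "Var_hat \<ge> 0"
    unfolding assms(8) by (intro divide_nonneg_nonneg sum_nonneg) auto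
  ultimately have var_pos: "var_star > 0"
    unfolding assms(6) using var_hat by (simp add: sum.distrib add_divide_distrib)

  have fsm: "finite_second_moment (P i)" and mean: "(\<integral>x. x \<partial>P i) = \<mu> i"
    and ent: "SE_entropy (P i) = (\<sigma> i)\<^sup>2" if "i \<in> {1..M}" for i
    using \<sigma>[OF that] P[OF that]
    by (simp_all add: finite_second_moment_gaussian gaussian_mean SE_entropy_gaussian)
  have sets: "sets (P i) = sets borel" if "i \<in> {1..M}" for i
    using fsm[OF that] by (simp add: finite_second_moment_def)
  have fsm_star: "finite_second_moment P_star" and mean_star: "(\<integral>x. x \<partial>P_star) = \<mu>_star"
    and ent_star: "SE_entropy P_star = var_star"
    unfolding assms(7) using var_pos
    by (simp_all add: finite_second_moment_gaussian gaussian_mean SE_entropy_gaussian)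
  have fsm_ens: "finite_second_moment P_ens"
    unfolding assms(4) using M fsm by (rule finite_second_moment_uniform_mixture)
  have "has_bochner_integral P_ens (\<lambda>x. x) ((\<Sum>i=1..M. \<integral>x. x \<partial>P i) / real M)"
    unfolding assms(4) using M sets has_bochner_integral_id[OF fsm]
    by (rule has_bochner_integral_uniform_mixture)
  then have mean_ens: "(\<integral>x. x \<partial>P_ens) = \<mu>_star"
    using mean assms(5) by (simp add: has_bochner_integral_iff)
  \<comment> \<open>The second moment is recovered as entropy plus squared mean by reading
    \<open>SE_entropy_eq\<close> backwards.\<close>
  have second: "has_bochner_integral (P i) (\<lambda>x. x\<^sup>2) ((\<sigma> i)\<^sup>2 + (\<mu> i)\<^sup>2)" if "i \<in> {1..M}" for i
    using fsm[OF that] SE_entropy_eq[OF fsm[OF that]] ent[OF that] mean[OF that]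
    by (simp add: has_bochner_integral_iff finite_second_moment_def)
  have "has_bochner_integral P_ens (\<lambda>x. x\<^sup>2) ((\<Sum>i=1..M. (\<sigma> i)\<^sup>2 + (\<mu> i)\<^sup>2) / real M)"
    unfolding assms(4) using M sets second by (rule has_bochner_integral_uniform_mixture)
  \<comment> \<open>Second moment minus squared mean of the mixture is exactly the defining
    expression of \<open>var_star\<close>.\<close>
  then have ent_ens: "SE_entropy P_ens = var_star"
    using SE_entropy_eq[OF fsm_ens] mean_ens assms(6) by (simp add: has_bochner_integral_iff)

  note div = SE_divergence_eq[OF fsm] SE_divergence_eq[OF fsm_star] SE_divergence_eq[OF fsm_ens]
  have ents: "(\<Sum>i=1..M. SE_entropy (P i)) = (\<Sum>i=1..M. (\<sigma> i)\<^sup>2)"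
    by (intro sum.cong refl ent)
  \<comment> \<open>\<open>SE_divergence_eq\<close> puts the mean of the prediction first, so the
    difference has to be reversed under the square.\<close>
  have divs: "(\<Sum>i=1..M. \<Sum>j=1..M. SE_divergence (P i) (P j)) = (\<Sum>i=1..M. \<Sum>j=1..M. (\<mu> j - \<mu> i)\<^sup>2)"
    by (intro sum.cong refl) (subst power2_commute, simp add: div(1) mean)
  \<comment> \<open>Stated for every \<open>Q\<close> with mean \<open>\<mu>_star\<close>, so that
    \<open>P_ens\<close> and \<open>P_star\<close> are both instances. In \<open>div_to\<close>,
    \<open>Q\<close> is the true distribution and must also have a finite second moment.\<close>
  have div_from: "(\<Sum>i=1..M. SE_divergence Q (P i)) / real M = Var_hat"
    if "(\<integral>x. x \<partial>Q) = \<mu>_star" for Q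
    using div(1)[of _ Q] mean that by (simp add: assms(8) power2_commute[of \<mu>_star])
  have div_to: "(\<Sum>i=1..M. SE_divergence (P i) Q) / real M = Var_hat"
    if "finite_second_moment Q" "(\<integral>x. x \<partial>Q) = \<mu>_star" for Q
    using mean by (simp add: assms(8) SE_divergence_eq[OF that(1)] that(2))
  have div0: "SE_divergence P_star P_ens = 0" "SE_divergence P_ens P_star = 0"
    by (simp_all add: div mean_ens mean_star)
  show ?thesis
    unfolding ents divs pairs div_from[OF mean_ens] div_from[OF mean_star]
      div_to[OF fsm_ens mean_ens] div_to[OF fsm_star mean_star] div0 ent_ens ent_star
    by (intro conjI refl assms(6))
qed

end
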